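(* Let $d(x)=cx^t+h$ and $g(x)=k/4$, with $c,k,h,t\in\mathbb{Z}$, $c\neq0$ and $k,t>0$, and let $\{\mathcal{F}_n(x)\}$ and $\{\mathcal{L}_n(x)\}$ be the Fibonacci-type and Lucas-type generalized Fibonacci polynomials determined by $d$ and $g$. Let $n\equiv m\pmod 2$. If $\omega(x)$ is a weight function, then for any $a>0$ the following statements hold: 1. $\displaystyle\int_{-a}^{a}\mathcal{F}_n(x)\mathcal{F}_m(x)\,\omega(x)\,dx\neq0.$ 2. $\displaystyle\int_{-a}^{a}\frac{\mathcal{L}_n(x)\mathcal{L}_m(x)}{\omega(x)}\,dx\neq0.$
   Context: Generalized Fibonacci polynomials (GFP): given nonzero polynomials $d(x),g(x)\in\mathbb{Q}[x]$ with $\deg d>\deg g$, the Fibonacci-type sequence is $\mathcal{F}_0(x)=0$, $\mathcal{F}_1(x)=1$, $\mathcal{F}_n(x)=d(x)\mathcal{F}_{n-1}(x)+g(x)\mathcal{F}_{n-2}(x)$ for $n\ge 2$. The Lucas-type sequence is $\mathcal{L}_0(x)=p_0$, $\mathcal{L}_1(x)=p_1(x)$, $\mathcal{L}_n(x)=d(x)\mathcal{L}_{n-1}(x)+g(x)\mathcal{L}_{n-2}(x)$ for $n\ge2$, where $p_0\in\{\pm1,\pm2\}$, $\alpha=2/p_0$, and $p_1(x)\in\mathbb{Q}[x]$ is a nonzero polynomial with $d(x)=\alpha p_1(x)$. Here $n,m$ are indices of these sequences. A weight function on an interval is a function $\omega(x)\ge0$ that is the density of a (positive) Borel measure $d\mu(x)=\omega(x)\,dx$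 on that interval.
   Formalization: Item 1 is stated for n, m ≥ 1, since F_0 = 0 makes the integral zero; the weight ω is required not to vanish almost everywhere on [-a,a]; integrals are Lebesgue integrals, possibly infinite, and the quotient in item 2 is taken as 0 where ω = 0. *)

theory Defs
  imports
    "HOL-Analysis.Analysis"
    "HOL-Computational_Algebra.Polynomial"
    "HOL-Number_Theory.Cong"
begin

fun fib_poly :: "rat poly \<Rightarrow> rat poly \<Rightarrow> nat \<Rightarrow> rat poly" where
  "fib_poly d g 0 = 0"
| "fib_poly d g (Suc 0) = 1"
| "fib_poly d g (Suc (Suc n)) = d * fib_poly d g (Suc n) + g * fib_poly d g n"

fun lucas_poly :: "rat \<Rightarrow> rat poly \<Rightarrow> rat poly \<Rightarrow> rat poly \<Rightarrow> nat \<Rightarrow> rat poly" where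
  "lucas_poly p0 p1 d g 0 = [:p0:]"
| "lucas_poly p0 p1 d g (Suc 0) = p1"
| "lucas_poly p0 p1 d g (Suc (Suc n)) =
     d * lucas_poly p0 p1 d g (Suc n) + g * lucas_poly p0 p1 d g n"

text \<open>The admissible data of a Lucas-type sequence; here \<open>2 / p0\<close> is the number usually
  called \<open>\<alpha>\<close>.\<close>

definition lucas_data :: "rat \<Rightarrow> rat poly \<Rightarrow> rat poly \<Rightarrow> bool" where
  "lucas_data p0 p1 d \<longleftrightarrow> p0 \<in> {1, -1, 2, -2} \<and> p1 \<noteq> 0 \<and> d = smult (2 / p0) p1"

definition rpoly :: "rat poly \<Rightarrow> real \<Rightarrow> real" where
  "rpoly p x = poly (map_poly of_rat p) x"

definition weight_measure :: "real set \<Rightarrow> (real \<Rightarrow> real) \<Rightarrow> real measure" where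
  "weight_measure I \<omega> = density (restrict_space lborel I) (\<lambda>x. ennreal (\<omega> x))"

text \<open>A weight is the nonnegative density of a positive Borel measure on \<open>I\<close>. Positivity is taken
  to mean that the measure is not the zero measure. The measure need not be finite, and \<open>\<omega>\<close>
  may vanish at some points of \<open>I\<close>; there a quotient \<open>f x / \<omega> x\<close> has the
  HOL value \<open>0\<close>, so its integral is the integral over the points where \<open>\<omega>\<close> is positive.\<close>

definition weight_on :: "real set \<Rightarrow> (real \<Rightarrow> real) \<Rightarrow> bool" where
  "weight_on I \<omega> \<longleftrightarrow>
     \<omega> \<in> borel_measurable (restrict_space lborel I) \<and>
     (\<forall>x\<in>I. 0 \<le> \<omega> x) \<and>
     emeasure (weight_measure I \<omega>) I \<noteq> 0"

text \<open>Lebesgue integrals with values in \<open>[-\<infinity>, \<infinity>]\<close>. A weight need not make the relevant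
  functions Lebesgue integrable, and the Bochner integral of a non-integrable function is \<open>0\<close>
  by convention, so it cannot be used to say that such an integral is nonzero. The integral exists
  if at least one of the positive and negative parts has finite integral.\<close>

definition ext_integrable :: "real set \<Rightarrow> (real \<Rightarrow> real) \<Rightarrow> bool" where
  "ext_integrable A f \<longleftrightarrow>
     set_borel_measurable lborel A f \<and>
     ((\<integral>\<^sup>+x\<in>A. ennreal (f x) \<partial>lborel) < \<infinity> \<or> (\<integral>\<^sup>+x\<in>A. ennreal (- f x) \<partial>lborel) < \<infinity>)"

definition ext_integral :: "real set \<Rightarrow> (real \<Rightarrow> real) \<Rightarrow> ereal" where
  "ext_integral A f =
     enn2ereal (\<integral>\<^sup>+x\<in>A. ennreal (f x) \<partial>lborel) - enn2ereal (\<integral>\<^sup>+x\<in>A. ennreal (- f x) \<partial>lborel)"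

lemma ext_integral_eq_set_lebesgue_integral:
  assumes "set_integrable lborel A f"
  shows "ext_integrable A f" "ext_integral A f = ereal (LINT x:A|lborel. f x)"
proof -
  let ?h = "\<lambda>x. indicator A x *\<^sub>R f x"
  have int: "integrable lborel ?h"
    using assms by (simp add: set_integrable_def)
  have p: "(\<integral>\<^sup>+x\<in>A. ennreal (f x) \<partial>lborel) = (\<integral>\<^sup>+x. ennreal (?h x) \<partial>lborel)"
    by (intro nn_integral_cong) (auto simp: indicator_def)
  have n: "(\<integral>\<^sup>+x\<in>A. ennreal (- f x) \<partial>lborel) = (\<integral>\<^sup>+x. ennreal (- ?h x) \<partial>lborel)"
    by (intro nn_integral_cong) (auto simp: indicator_def)
  have fin: "(\<integral>\<^sup>+x. ennreal (?h x) \<partial>lborel) \<noteq> \<infinity>" "(\<integral>\<^sup>+x. ennreal (- ?h x) \<partial>lborel) \<noteq> \<infinity>"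
    using int by (auto simp: real_integrable_def)
  show "ext_integrable A f"
    using int fin p n
    by (auto simp: ext_integrable_def set_borel_measurable_def real_integrable_def top.not_eq_extremum)
  show "ext_integral A f = ereal (LINT x:A|lborel. f x)"
    using fin unfolding ext_integral_def p n set_lebesgue_integral_def
      real_lebesgue_integral_def[OF int]
    by (cases "\<integral>\<^sup>+x. ennreal (?h x) \<partial>lborel"; cases "\<integral>\<^sup>+x. ennreal (- ?h x) \<partial>lborel")
       (auto simp: enn2ereal_ennreal)
qed

end

(*
  At a point where d takes the value D, both sequences satisfy s (n + 2) = D s (n + 1) + G s n with
  G > 0 and s 1 a positive multiple of D s 0. Hence s n is s 0 * D ^ (n mod 2) times a positive
  number, so for indices of equal parity the product s n s m is nonnegative and vanishes only where
  D = 0, that is, at finitely many points. Its integral against the weight (or its reciprocal) could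
  then vanish only if the weight were zero almost everywhere.
*)
theory Submission
  imports Defs
begin

lemma rpoly_0 [simp]: "rpoly 0 x = 0"
  by (simp add: rpoly_def)

lemma rpoly_pCons [simp]: "rpoly (pCons a p) x = of_rat a + x * rpoly p x"
  by (simp add: rpoly_def map_poly_pCons)

lemma rpoly_1 [simp]: "rpoly 1 x = 1"
  by (simp add: one_pCons)

lemma rpoly_add [simp]: "rpoly (p + q) x = rpoly p x + rpoly q x"
  by (induction p q rule: poly_induct2) (simp_all add: of_rat_add algebra_simps)

lemma rpoly_smult [simp]: "rpoly (smult a p) x = of_rat a * rpoly p x"
  by (induction p) (simp_all add: of_rat_mult algebra_simps)

lemma rpoly_mult [simp]: "rpoly (p * q) x = rpoly p x * rpoly q x"
  by (induction p) (simp_all add: algebra_simps)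

lemma borel_measurable_rpoly [measurable]: "rpoly p \<in> borel_measurable borel"
  unfolding rpoly_def by (intro borel_measurable_continuous_onI continuous_intros)

lemma finite_rpoly_zeros:
  assumes "p \<noteq> 0"
  shows "finite {x. rpoly p x = 0}"
proof -
  have "map_poly of_rat p \<noteq> (0 :: real poly)"
    using assms by (metis coeff_0 coeff_map_poly leading_coeff_neq_0 of_rat_0 of_rat_eq_0_iff)
  then show ?thesis
    unfolding rpoly_def by (rule poly_roots_finite)
qed

text \<open>Induction goes over pairs of consecutive terms, because the claim for an even index
  draws on the odd one before it and vice versa. In passing to the next even index the factor
  \<open>D\<close> is met a second time and becomes a square, so the sign of \<open>D\<close>
  survives only at odd indices.\<close>

lemma two_term_recurrence_factor:
  fixes s :: "nat \<Rightarrow> real"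
  assumes "G > 0" "\<kappa> > 0" "s 1 = \<kappa> * D * s 0"
    and rec: "\<And>n. s (Suc (Suc n)) = D * s (Suc n) + G * s n"
  shows "\<exists>u>0. s n = s 0 * D ^ (n mod 2) * u"
proof -
  have "\<exists>u>0. \<exists>v>0. s (2 * j) = s 0 * u \<and> s (Suc (2 * j)) = s 0 * D * v" for j
  proof (induction j)
    case 0
    show ?case
      using assms(2,3) by (intro exI[of _ 1] conjI exI[of _ \<kappa>]) auto
  next
    case (Suc j)
    then obtain u v where uv: "u > 0" "v > 0" "s (2 * j) = s 0 * u" "s (Suc (2 * j)) = s 0 * D * v"
      by blast
    \<comment> \<open>This is what remains of \<open>D * s (Suc (2 * j)) + G * s (2 * j)\<close>
      once \<open>s 0\<close> is factored out. As \<open>D\<close> may be zero, strict positivity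
      rests on the term \<open>G * u\<close>.\<close>
    define u' where "u' = D\<^sup>2 * v + G * u"
    have "u' > 0"
      unfolding u'_def using uv \<open>G > 0\<close> by (intro add_nonneg_pos) simp_all
    then have pos: "u' > 0" "u' + G * v > 0"
      using uv \<open>G > 0\<close> by (simp_all add: add_pos_pos)
    have even: "s (2 * Suc j) = s 0 * u'"
      using rec[of "2 * j"] uv by (simp add: u'_def algebra_simps power2_eq_square)
    then have "s (Suc (2 * Suc j)) = s 0 * D * (u' + G * v)"
      using rec[of "Suc (2 * j)"] uv by (simp add: algebra_simps)
    with pos even show ?case
      by blast
  qed
  from this[of "n div 2"] show ?thesis
    by (cases "even n") (auto simp: parity_cases elim!: evenE oddE)
qed

text \<open>Equal parity gives both terms the same power of \<open>D\<close>, so the product is a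
  square times a positive number.\<close>

lemma two_term_recurrence_product:
  fixes s :: "nat \<Rightarrow> real"
  assumes "G > 0" "\<kappa> > 0" "s 1 = \<kappa> * D * s 0" "s 0 \<noteq> 0"
    and "\<And>n. s (Suc (Suc n)) = D * s (Suc n) + G * s n"
    and "[n = m] (mod 2)"
  shows "s n * s m \<ge> 0" "D \<noteq> 0 \<Longrightarrow> s n * s m > 0"
proof -
  note factor = two_term_recurrence_factor[of G \<kappa> s D, OF assms(1-3,5)]
  obtain u where u: "u > 0" "s n = s 0 * D ^ (n mod 2) * u"
    using factor by blast
  obtain v where v: "v > 0" "s m = s 0 * D ^ (n mod 2) * v"
    using factor[of m] assms(6) by (auto simp: cong_def)
  have eq: "s n * s m = (s 0 * D ^ (n mod 2))\<^sup>2 * (u * v)"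
    by (simp add: u(2) v(2) power2_eq_square)
  show "s n * s m \<ge> 0" "D \<noteq> 0 \<Longrightarrow> s n * s m > 0"
    unfolding eq using u(1) v(1) assms(4) by auto
qed

text \<open>The mass of \<open>I\<close> under \<open>weight_measure I \<omega>\<close> is the
  integral of the density, so a density vanishing almost everywhere on \<open>I\<close> would
  contradict the positivity demanded by \<open>weight_on\<close>.\<close>

lemma weight_on_not_AE_zero:
  assumes "weight_on I \<omega>" and I: "I \<in> sets borel"
  shows "\<not> (AE x in lborel. x \<in> I \<longrightarrow> \<omega> x = 0)"
proof
  assume ae: "AE x in lborel. x \<in> I \<longrightarrow> \<omega> x = 0"
  have meas: "(\<lambda>x. ennreal (\<omega> x)) \<in> borel_measurable (restrict_space lborel I)"
    using assms(1) by (auto simp: weight_on_def)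
  have sets_I: "I \<in> sets (restrict_space lborel I)"
    using I by (auto simp: sets_restrict_space image_iff)
  have "emeasure (weight_measure I \<omega>) I =
      (\<integral>\<^sup>+x. ennreal (\<omega> x) * indicator I x \<partial>restrict_space lborel I)"
    unfolding weight_measure_def using meas sets_I by (rule emeasure_density)
  also have "\<dots> = 0"
  proof (subst nn_integral_0_iff_AE)
    show "(\<lambda>x. ennreal (\<omega> x) * indicator I x) \<in> borel_measurable (restrict_space lborel I)"
      using meas sets_I by measurable
    show "AE x in restrict_space lborel I. ennreal (\<omega> x) * indicator I x = 0"
      using ae I by (auto simp: AE_restrict_space_iff)
  qed
  finally show False
    using assms(1) by (simp add: weight_on_def)
qed

text \<open>The function \<open>q\<close> lets one argument serve for multiplication by the weight
  (\<open>q\<close> the identity) and for division by it (\<open>q\<close> the inverse). Since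
  \<open>inverse 0 = 0\<close>, both choices vanish exactly at 0.\<close>

lemma ext_integral_weighted_nonzero:
  fixes f q \<omega> :: "real \<Rightarrow> real"
  assumes w: "weight_on I \<omega>" and I: "I \<in> sets borel"
    and f [measurable]: "f \<in> borel_measurable borel" and f_nonneg: "\<And>x. f x \<ge> 0"
    and fin: "finite {x. f x = 0}"
    and q [measurable]: "q \<in> borel_measurable borel"
    and q_nonneg: "\<And>y. y \<ge> 0 \<Longrightarrow> q y \<ge> 0" and q_eq_0: "\<And>y. q y = 0 \<longleftrightarrow> y = 0"
  shows "ext_integrable I (\<lambda>x. f x * q (\<omega> x)) \<and> ext_integral I (\<lambda>x. f x * q (\<omega> x)) \<noteq> 0"
proof -
  let ?h = "\<lambda>x. f x * q (\<omega> x)"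
  have w_nonneg: "\<And>x. x \<in> I \<Longrightarrow> \<omega> x \<ge> 0"
    and w_meas: "\<omega> \<in> borel_measurable (restrict_space lborel I)"
    using w by (auto simp: weight_on_def)
  have h_nonneg: "?h x \<ge> 0" if "x \<in> I" for x
    using f_nonneg q_nonneg w_nonneg[OF that] by simp
  have "f \<in> borel_measurable (restrict_space lborel I)"
    by (rule measurable_restrict_space1) simp
  then have "?h \<in> borel_measurable (restrict_space lborel I)"
    using w_meas by measurable
  then have meas: "set_borel_measurable lborel I ?h"
    using I by (simp add: set_borel_measurable_def borel_measurable_restrict_space_iff)
  \<comment> \<open>With no negative part the extended integral exists and equals the integral of
    the positive part, even if that is infinite.\<close>
  have neg: "(\<integral>\<^sup>+x\<in>I. ennreal (- ?h x) \<partial>lborel) = 0"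
  proof -
    have "(\<integral>\<^sup>+x\<in>I. ennreal (- ?h x) \<partial>lborel) = (\<integral>\<^sup>+x. 0 \<partial>(lborel :: real measure))"
      using h_nonneg by (intro nn_integral_cong) (auto simp: indicator_def ennreal_neg)
    then show ?thesis
      by simp
  qed
  have pos: "(\<integral>\<^sup>+x\<in>I. ennreal (?h x) \<partial>lborel) \<noteq> 0"
  proof
    assume zero: "(\<integral>\<^sup>+x\<in>I. ennreal (?h x) \<partial>lborel) = 0"
    have "(\<integral>\<^sup>+x. ennreal (indicator I x *\<^sub>R ?h x) \<partial>lborel) = (\<integral>\<^sup>+x\<in>I. ennreal (?h x) \<partial>lborel)"
      by (rule nn_integral_cong) (simp add: indicator_def)
    moreover have "(\<lambda>x. ennreal (indicator I x *\<^sub>R ?h x)) \<in> borel_measurable lborel"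
      using meas unfolding set_borel_measurable_def by (rule measurable_compose) simp
    ultimately have "AE x in lborel. ennreal (indicator I x *\<^sub>R ?h x) = 0"
      using zero nn_integral_0_iff_AE by fastforce
    \<comment> \<open>Off this null set a vanishing integrand can only come from the factor
      \<open>q (\<omega> x)\<close>, hence from a zero of the weight.\<close>
    moreover have "AE x in lborel. x \<notin> {x. f x = 0}"
      by (rule AE_not_in[OF finite_imp_null_set_lborel[OF fin]])
    ultimately have "AE x in lborel. x \<in> I \<longrightarrow> \<omega> x = 0"
    proof eventually_elim
      case (elim x)
      show ?case
      proof
        assume x: "x \<in> I"
        with elim(1) have "?h x \<le> 0"
          by (simp add: ennreal_eq_0_iff)
        with h_nonneg[OF x] have "?h x = 0"
          by (rule antisym[rotated])
        with elim(2) show "\<omega> x = 0"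
          by (simp add: q_eq_0)
      qed
    qed
    with weight_on_not_AE_zero[OF w I] show False ..
  qed
  then have "enn2ereal (\<integral>\<^sup>+x\<in>I. ennreal (?h x) \<partial>lborel) \<noteq> 0"
    by (metis enn2ereal_inject zero_ennreal.rep_eq)
  then show ?thesis
    unfolding ext_integrable_def ext_integral_def neg using meas
    by (simp add: zero_ennreal.rep_eq)
qed

theorem corollary3p8:
  fixes c h k :: int and t n m :: nat
    and d g p1 :: "rat poly" and p0 :: rat
    and \<omega> :: "real \<Rightarrow> real" and a :: real
  assumes "c \<noteq> 0" and "k > 0" and "t > 0"
    and "d = monom (of_int c) t + [:of_int h:]"
    and "g = [:of_int k / 4:]"
    and "lucas_data p0 p1 d"
    and "[n = m] (mod 2)"
    and "a > 0"
    and "weight_on {-a..a} \<omega>"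
  shows
    "(n \<ge> 1 \<and> m \<ge> 1 \<longrightarrow>
        ext_integrable {-a..a} (\<lambda>x. rpoly (fib_poly d g n) x * rpoly (fib_poly d g m) x * \<omega> x) \<and>
        ext_integral {-a..a} (\<lambda>x. rpoly (fib_poly d g n) x * rpoly (fib_poly d g m) x * \<omega> x) \<noteq> 0) \<and>
     (ext_integrable {-a..a}
        (\<lambda>x. rpoly (lucas_poly p0 p1 d g n) x * rpoly (lucas_poly p0 p1 d g m) x / \<omega> x) \<and>
      ext_integral {-a..a}
        (\<lambda>x. rpoly (lucas_poly p0 p1 d g n) x * rpoly (lucas_poly p0 p1 d g m) x / \<omega> x) \<noteq> 0)"
proof (intro conjI[of "_ \<longrightarrow> _"] impI)
  let ?I = "{-a..a}" and ?G = "of_rat (of_int k / 4) :: real"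
  have G: "?G > 0"
    using assms(2) by simp
  have g: "rpoly g x = ?G" for x
    by (simp add: assms(5))
  \<comment> \<open>This coefficient is \<open>c\<close>: as \<open>t > 0\<close>, the constant
    \<open>h\<close> does not contribute to it.\<close>
  have "coeff d t \<noteq> 0"
    using assms(1,3) by (cases t) (auto simp: assms(4))
  then have d_zeros: "finite {x. rpoly d x = 0}"
    by (intro finite_rpoly_zeros) auto
  {
    assume nm: "n \<ge> 1 \<and> m \<ge> 1"
    \<comment> \<open>The Fibonacci-type sequence starts with the zero polynomial, while the product
      lemma needs a nonzero initial value. The shift makes the sequence start with 1 and
      \<open>d\<close>, so that \<kappa> is 1; lowering both indices by one keeps their parities
      equal.\<close>
    define s where "s x j = rpoly (fib_poly d g (Suc j)) x" for x j
    have "[n - 1 = m - 1] (mod 2)"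
      using nm assms(7) cong_add_rcancel_nat[of "n - 1" 1 "m - 1" 2] by simp
    note prod = two_term_recurrence_product[OF G zero_less_one, of "s x" "rpoly d x" for x, OF _ _ _ this]
    have prod': "s x (n - 1) * s x (m - 1) \<ge> 0"
      "rpoly d x \<noteq> 0 \<Longrightarrow> s x (n - 1) * s x (m - 1) > 0" for x
      by (rule prod; simp add: s_def g)+
    \<comment> \<open>Strict positivity where \<open>d\<close> is nonzero confines the zeros of the
      product to those of \<open>d\<close>.\<close>
    have "finite {x. s x (n - 1) * s x (m - 1) = 0}"
      using prod'(2) by (intro finite_subset[OF _ d_zeros]) force
    then show "ext_integrable ?I (\<lambda>x. rpoly (fib_poly d g n) x * rpoly (fib_poly d g m) x * \<omega> x) \<and>
        ext_integral ?I (\<lambda>x. rpoly (fib_poly d g n) x * rpoly (fib_poly d g m) x * \<omega> x) \<noteq> 0"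
      using nm prod'(1)
      by (intro ext_integral_weighted_nonzero[OF assms(9), where q = "\<lambda>y. y"]) (auto simp: s_def)
  }
  define s where "s x j = rpoly (lucas_poly p0 p1 d g j) x" for x j
  have p0: "p0 \<noteq> 0" and p1: "d = smult (2 / p0) p1"
    using assms(6) by (auto simp: lucas_data_def)
  \<comment> \<open>Solving \<open>d = smult (2 / p0) p1\<close> for \<open>p1\<close> yields the
    initial relation with \<kappa> equal to 1/2, whatever the sign of \<open>p0\<close>.\<close>
  have p1': "rpoly p1 x = 1 / 2 * rpoly d x * of_rat p0" for x
    using p0 by (simp add: p1 of_rat_divide)
  have prod: "s x n * s x m \<ge> 0" "rpoly d x \<noteq> 0 \<Longrightarrow> s x n * s x m > 0" for x
    by (rule two_term_recurrence_product[OF G, where \<kappa> = "1 / 2" and D = "rpoly d x"];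
        simp add: s_def g p0 p1' assms(7))+
  have "finite {x. s x n * s x m = 0}"
    using prod(2) by (intro finite_subset[OF _ d_zeros]) force
  then show "ext_integrable ?I
        (\<lambda>x. rpoly (lucas_poly p0 p1 d g n) x * rpoly (lucas_poly p0 p1 d g m) x / \<omega> x) \<and>
      ext_integral ?I
        (\<lambda>x. rpoly (lucas_poly p0 p1 d g n) x * rpoly (lucas_poly p0 p1 d g m) x / \<omega> x) \<noteq> 0"
    \<comment> \<open>The quotient becomes a product with \<open>inverse (\<omega> x)\<close>, which
      makes \<open>inverse\<close> the function \<open>q\<close>.\<close>
    unfolding divide_inverse using prod(1)
    by (intro ext_integral_weighted_nonzero[OF assms(9)]) (auto simp: s_def)
qed

end
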